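(* Let $N$ be a positive integer which is not a perfect square, let $p$ be an integer with $p^2<N$, let $q$ be a positive integer dividing $N-p^2$, and put $\alpha=\frac{\sqrt N+p}{q}$. Let $(x_n)_{n\ge0}$ be the sequence of numbers in the left-positive path (LPP) of $\alpha$ and let $T$ be its least period. If $m\in\{1,2,\dots,T\}$ is such that $x_m=-\alpha^*$, then for every $n\in\{0,1,\dots,m\}$, $x_{m-n}=-x_n^*$, and $x_{n+1}$ and $x_{m-n}$ are either both left children or both right children of their parents in the LPP (where, for $n=m$, the number $x_0=\alpha$ is regarded as $x_T$, the child of $x_{T-1}$).
   Context: The Calkin-Wilf tree of $\alpha$ is the infinite binary tree whose root is labeled $\alpha$ and in which every vertex labeled $x$ has a left child labeled $\frac{x}{x+1}$ and a right child labeled $x+1$ (since $\alpha>0$, all labels are positive). Each vertex carries a triple $(\varepsilon,c,d)$ with $\varepsilon\in\{-1,1\}$, $c$ an integer, $d$ a positive integer dividing $N-c^2$, and label equal to $\frac{\varepsilon\sqrt N+c}{d}$, defined as follows. The root has triple $(1,p,q)$. If a vertex has triple $(\varepsilon,c,d)$, its right child has triple $(\varepsilon,c+d,d)$; its left child has triple $\left(-\varepsilon,\frac{N-c^2}{d}-c,\frac{N-(c+d)^2}{d}\right)$ if $N-(c+d)^2>0$, and $\left(\varepsilon,c-\frac{N-c^2}{d},\frac{(c+d)^2-N}{d}\right)$ otherwise. The left-positive path (LPP) of $\alpha$ is the infinite descending path which starts at the root and which, from each vertex, goes to the left child if the value of $\varepsilon$ for that left child is $1$, and to the right child otherwise. $x_n$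 denotes the label of the $n$-th vertex of the LPP, with $x_0=\alpha$. The parent of $x_{n+1}$ is $x_n$; "$x_{n+1}$ is the left (resp. right) child of $x_n$" means that the $(n+1)$-st step of the path, from $x_n$ to $x_{n+1}$, goes left (resp. right). The sequence $(x_n)$ is purely periodic, and $T$ denotes its least period, i.e. the least positive integer such that $x_T=\alpha$. For rational numbers $a,b$, the algebraic conjugate of $x=a\sqrt N+b$ is $x^*=-a\sqrt N+b$. *)

theory Defs
  imports Complex_Main
begin

datatype direction = Left | Right

text \<open>A vertex of the infinite binary tree is the list of directions leading to it from the root,
  with the last step at the head of the list; thus \<open>Left # v\<close> and \<open>Right # v\<close> are
  the children of \<open>v\<close>, and the root is \<open>[]\<close>.\<close>

type_synonym vertex = "direction list"

primrec child_label :: "direction \<Rightarrow> real \<Rightarrow> real" where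
  "child_label Left x = x / (x + 1)"
| "child_label Right x = x + 1"

primrec cw_label :: "real \<Rightarrow> vertex \<Rightarrow> real" where
  "cw_label \<alpha> [] = \<alpha>"
| "cw_label \<alpha> (s # v) = child_label s (cw_label \<alpha> v)"

text \<open>The divisions below are exact on the triples that occur in the tree of
  \<open>(sqrt N + p) / q\<close> with \<open>q dvd N - p\<^sup>2\<close>, since \<open>d dvd N - c\<^sup>2\<close> is inherited by
  both children.\<close>

fun child_triple :: "int \<Rightarrow> direction \<Rightarrow> int \<times> int \<times> int \<Rightarrow> int \<times> int \<times> int" where
  "child_triple N Right (e, c, d) = (e, c + d, d)"
| "child_triple N Left (e, c, d) =
     (if N - (c + d)\<^sup>2 > 0
      then (- e, (N - c\<^sup>2) div d - c, (N - (c + d)\<^sup>2) div d)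
      else (e, c - (N - c\<^sup>2) div d, ((c + d)\<^sup>2 - N) div d))"

primrec cw_triple :: "int \<Rightarrow> int \<Rightarrow> int \<Rightarrow> vertex \<Rightarrow> int \<times> int \<times> int" where
  "cw_triple N p q [] = (1, p, q)"
| "cw_triple N p q (s # v) = child_triple N s (cw_triple N p q v)"

definition quad_irr :: "int \<Rightarrow> int \<Rightarrow> int \<Rightarrow> real" where
  "quad_irr N p q = (sqrt (of_int N) + of_int p) / of_int q"

primrec lpp :: "int \<Rightarrow> int \<Rightarrow> int \<Rightarrow> nat \<Rightarrow> vertex" where
  "lpp N p q 0 = []"
| "lpp N p q (Suc n) =
     (if fst (cw_triple N p q (Left # lpp N p q n)) = 1
      then Left # lpp N p q n else Right # lpp N p q n)"

definition lpp_seq :: "int \<Rightarrow> int \<Rightarrow> int \<Rightarrow> nat \<Rightarrow> real" where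
  "lpp_seq N p q n = cw_label (quad_irr N p q) (lpp N p q n)"

text \<open>The next two predicates are meaningful for \<open>n \<ge> 1\<close> only; both are false at the root.\<close>

definition is_left_child :: "int \<Rightarrow> int \<Rightarrow> int \<Rightarrow> nat \<Rightarrow> bool" where
  "is_left_child N p q n \<longleftrightarrow> lpp N p q n = Left # lpp N p q (n - 1)"

definition is_right_child :: "int \<Rightarrow> int \<Rightarrow> int \<Rightarrow> nat \<Rightarrow> bool" where
  "is_right_child N p q n \<longleftrightarrow> lpp N p q n = Right # lpp N p q (n - 1)"

definition lpp_period :: "int \<Rightarrow> int \<Rightarrow> int \<Rightarrow> nat" where
  "lpp_period N p q = (LEAST t. 0 < t \<and> lpp_seq N p q t = quad_irr N p q)"

text \<open>Conjugation is a function on the numbers \<open>a * sqrt N + b\<close> with \<open>a\<close>, \<open>b\<close> rational; it is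
  well defined because \<open>sqrt N\<close> is irrational when \<open>N\<close> is not a perfect square. On other reals
  its value is unspecified.\<close>

definition quad_conj :: "int \<Rightarrow> real \<Rightarrow> real" where
  "quad_conj N x =
     (THE y. \<exists>a\<in>\<rat>. \<exists>b\<in>\<rat>. x = a * sqrt (of_int N) + b \<and> y = - a * sqrt (of_int N) + b)"

end

theory Submission
  imports Defs
begin

text \<open>A vertex \<open>(1, c, d)\<close> of the LPP is encoded by \<open>(c, d, e)\<close> with \<open>d * e = N - c\<^sup>2\<close>, where
  \<open>d, e > 0\<close>. The step of the LPP becomes a map on such triples that is governed by the sign of
  \<open>d + 2 * c - e\<close>, and \<open>x \<mapsto> - x\<^sup>*\<close> becomes the involution \<open>c \<mapsto> - c\<close>. This involution conjugates the
  step to its inverse, preserving directions; so the path, once it reaches \<open>- \<alpha>\<^sup>*\<close>, has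
  retraced its own mirror image. Injectivity of the step on the finite set of triples gives
  the periodicity needed at \<open>n = m\<close>.\<close>

section \<open>The step of the path on reduced triples\<close>

type_synonym form = "int \<times> int \<times> int"

text \<open>A triple holds the coefficients of \<open>d * x\<^sup>2 - 2 * c * x - e\<close>, whose
  positive root is \<open>(sqrt N + c) / d\<close>. Keeping \<open>e\<close> frees the step from
  division; positivity of \<open>d\<close> and \<open>e\<close> gives the roots opposite
  signs.\<close>

definition forms :: "int \<Rightarrow> form set" where
  "forms N = {(c, d, e). 0 < d \<and> 0 < e \<and> c\<^sup>2 + d * e = N}"

text \<open>On \<open>forms N\<close>, \<open>d + 2 * c - e\<close> is the value of this polynomial
  at -1, which is negative exactly when the conjugate root lies below -1. The chosen child is thus
  the one whose conjugate stays negative.\<close>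

fun dir :: "form \<Rightarrow> direction" where
  "dir (c, d, e) = (if d + 2 * c - e < 0 then Right else Left)"

fun step :: "form \<Rightarrow> form" where
  "step (c, d, e) =
     (if d + 2 * c - e < 0 then (c + d, d, e - 2 * c - d) else (c - e, d + 2 * c - e, e))"

fun mirror :: "form \<Rightarrow> form" where
  "mirror (c, d, e) = (- c, d, e)"

fun form_value :: "int \<Rightarrow> form \<Rightarrow> real" where
  "form_value N (c, d, e) = quad_irr N c d"

text \<open>A zero would make \<open>N\<close> the square of \<open>c + d\<close>. Excluding it
  keeps the new middle entry after a left step strictly positive.\<close>

lemma forms_discriminant_nonzero:
  assumes "\<nexists>k::int. N = k\<^sup>2" "(c, d, e) \<in> forms N"
  shows "d + 2 * c - e \<noteq> 0"
proof
  assume "d + 2 * c - e = 0"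
  then have e: "e = d + 2 * c" by simp
  have "N = (c + d)\<^sup>2"
    using assms(2) unfolding forms_def e by (auto simp: power2_eq_square algebra_simps)
  with assms(1) show False by blast
qed

lemma step_in_forms:
  assumes "\<nexists>k::int. N = k\<^sup>2" "t \<in> forms N"
  shows "step t \<in> forms N"
proof -
  obtain c d e where t: "t = (c, d, e)" by (cases t)
  show ?thesis
    using assms(2) forms_discriminant_nonzero[of N c d e] assms unfolding t
    by (auto simp: forms_def power2_eq_square algebra_simps)
qed

lemma mirror_in_forms: "t \<in> forms N \<Longrightarrow> mirror t \<in> forms N"
  by (cases t) (auto simp: forms_def)

lemma mirror_mirror [simp]: "mirror (mirror t) = t"
  by (cases t) auto

text \<open>At \<open>mirror (step t)\<close> the decisive quantity is \<open>- e\<close> after a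
  right step and \<open>d\<close> after a left step. Positivity therefore selects the same branch
  again, which undoes the step up to \<open>mirror\<close>.\<close>

lemma step_mirror_step:
  assumes "\<nexists>k::int. N = k\<^sup>2" "t \<in> forms N"
  shows "step (mirror (step t)) = mirror t" "dir (mirror (step t)) = dir t"
  using assms forms_discriminant_nonzero[OF assms(1)]
  by (cases t; force simp: forms_def)+

text \<open>The reversal law makes \<open>mirror \<circ> step \<circ> mirror\<close> a left inverse
  of \<open>step\<close> on \<open>forms N\<close>.\<close>

lemma inj_on_step:
  assumes "\<nexists>k::int. N = k\<^sup>2"
  shows "inj_on step (forms N)"
  by (rule inj_onI) (metis assms mirror_mirror step_mirror_step(1))

lemma finite_forms: "finite (forms N)"
proof (rule finite_subset)
  show "forms N \<subseteq> {-N..N} \<times> {0..N} \<times> {0..N}"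
  proof
    fix t assume "t \<in> forms N"
    then obtain c d e where t: "t = (c, d, e)" "0 < d" "0 < e" "c\<^sup>2 + d * e = N"
      by (auto simp: forms_def)
    have "d \<le> d * e" "e \<le> d * e" using t(2,3) by auto
    moreover have "\<bar>c\<bar> \<le> c\<^sup>2"
      using self_le_power[of "\<bar>c\<bar>" 2] by (cases "c = 0") auto
    moreover have "0 \<le> c\<^sup>2" by simp
    ultimately have "- N \<le> c \<and> c \<le> N \<and> d \<le> N \<and> e \<le> N"
      using t(2-4) by (intro conjI; linarith)
    then show "t \<in> {-N..N} \<times> {0..N} \<times> {0..N}" using t(1-3) by simp
  qed
qed simp

lemma funpow_step_in_forms:
  assumes "\<nexists>k::int. N = k\<^sup>2" "t \<in> forms N"
  shows "(step ^^ n) t \<in> forms N"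
  by (induction n) (auto simp: assms step_in_forms simp del: step.simps)

text \<open>Finiteness forces two equal iterates; injectivity strips off their common initial steps,
  so the orbit returns to \<open>t\<close> itself.\<close>

lemma step_orbit_periodic:
  assumes "\<nexists>k::int. N = k\<^sup>2" "t \<in> forms N"
  obtains k where "0 < k" "(step ^^ k) t = t"
proof -
  have cancel: "(step ^^ (j - i)) t = t" if "(step ^^ i) t = (step ^^ j) t" "i \<le> j" for i j
    using that
  proof (induction i arbitrary: j)
    case (Suc i)
    then obtain j' where j: "j = Suc j'" by (cases j) auto
    have "(step ^^ i) t = (step ^^ j') t"
      using Suc.prems(1) inj_on_step[OF assms(1)] funpow_step_in_forms[OF assms]
      by (auto simp: j dest: inj_onD)
    then show ?case using Suc.IH[of j'] Suc.prems(2) j by simp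
  qed simp
  have "\<not> inj (\<lambda>n. (step ^^ n) t)"
  proof
    assume "inj (\<lambda>n. (step ^^ n) t)"
    moreover have "finite (range (\<lambda>n. (step ^^ n) t))"
      using funpow_step_in_forms[OF assms]
      by (intro finite_subset[OF _ finite_forms[of N]]) auto
    ultimately show False using finite_imageD by blast
  qed
  then obtain i j where "(step ^^ i) t = (step ^^ j) t" "i < j"
    by (metis (mono_tags, lifting) injI linorder_neqE_nat)
  then show ?thesis using that[of "j - i"] cancel by simp
qed

lemma mirror_funpow_step:
  assumes "\<nexists>k::int. N = k\<^sup>2" "t \<in> forms N"
    and "(step ^^ m) t = mirror t" "n \<le> m"
  shows "(step ^^ (m - n)) t = mirror ((step ^^ n) t)"
  using assms(4)
proof (induction n)
  case (Suc n)
  have "step ((step ^^ (m - Suc n)) t) = mirror ((step ^^ n) t)"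
    using Suc by (simp flip: funpow.simps(2)[THEN fun_cong, unfolded comp_def] add: Suc_diff_Suc)
  \<comment> \<open>Reversal puts the right-hand side under \<open>step\<close> as well, so that
    injectivity can cancel it.\<close>
  also have "\<dots> = step (mirror (step ((step ^^ n) t)))"
    by (simp only: step_mirror_step(1)[OF assms(1) funpow_step_in_forms[OF assms(1,2)]])
  finally have "(step ^^ (m - Suc n)) t = mirror (step ((step ^^ n) t))"
    by (rule inj_onD[OF inj_on_step[OF assms(1)]])
      (intro funpow_step_in_forms mirror_in_forms step_in_forms assms(1,2))+
  then show ?case by (simp del: step.simps mirror.simps)
qed (simp add: assms)

section \<open>Conjugation\<close>

lemma sqrt_int_irrational:
  assumes "\<nexists>k::int. N = k\<^sup>2" "N > 0"
  shows "sqrt (of_int N) \<notin> \<rat>"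
proof
  assume "sqrt (of_int N) \<in> \<rat>"
  then obtain a b :: nat where ab: "b \<noteq> 0" "\<bar>sqrt (of_int N)\<bar> = real a / real b" "coprime a b"
    by (rule Rats_abs_nat_div_natE)
  then have "sqrt (of_int N) * real b = real a" using assms(2) by (simp add: field_simps)
  then have "(real a)\<^sup>2 = of_int N * (real b)\<^sup>2"
    using assms(2) by (metis of_int_0_le_iff order_less_imp_le power_mult_distrib real_sqrt_pow2)
  then have "real_of_int ((int a)\<^sup>2) = real_of_int (N * (int b)\<^sup>2)" by simp
  then have eq: "(int a)\<^sup>2 = N * (int b)\<^sup>2" by (simp only: of_int_eq_iff)
  then have "(int b)\<^sup>2 dvd (int a)\<^sup>2" by simp
  then have "b dvd a" by simp
  with ab(3) have "b = 1" by (metis coprime_common_divisor_nat dvd_refl)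
  with eq have "N = (int a)\<^sup>2" by simp
  with assms(1) show False by blast
qed

text \<open>Different leading coefficients would express \<open>s\<close> as a quotient of
  rationals. Uniqueness justifies the description operator in \<open>quad_conj\<close> and lets a
  triple be recovered from its number.\<close>

lemma quadratic_coeffs_unique:
  fixes a b a' b' :: real
  assumes "s \<notin> \<rat>" "a \<in> \<rat>" "b \<in> \<rat>" "a' \<in> \<rat>" "b' \<in> \<rat>" "a * s + b = a' * s + b'"
  shows "a = a' \<and> b = b'"
proof (cases "a = a'")
  case False
  with assms(6) have "s = (b' - b) / (a - a')" by (simp add: field_simps)
  with assms show ?thesis by (metis Rats_diff Rats_divide)
qed (use assms in simp)

lemma quad_conj_eq:
  assumes "\<nexists>k::int. N = k\<^sup>2" "N > 0" "a \<in> \<rat>" "b \<in> \<rat>"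
  shows "quad_conj N (a * sqrt (of_int N) + b) = - a * sqrt (of_int N) + b"
  unfolding quad_conj_def
  by (rule the_equality)
    (use assms quadratic_coeffs_unique[OF sqrt_int_irrational[OF assms(1,2)]] in blast)+

lemma quad_irr_coeffs:
  "quad_irr N c d = (1 / of_int d) * sqrt (of_int N) + of_int c / of_int d"
  by (simp add: quad_irr_def add_divide_distrib)

lemma quad_conj_form_value:
  assumes "\<nexists>k::int. N = k\<^sup>2" "N > 0"
  shows "form_value N (mirror t) = - quad_conj N (form_value N t)"
  by (cases t) (simp add: quad_irr_coeffs
      quad_conj_eq[OF assms, of "1 / of_int _" "of_int _ / of_int _", simplified])

text \<open>The coefficients of the number determine \<open>d\<close>, then \<open>c\<close>, and
  the equation for \<open>N\<close> then determines \<open>e\<close>. This turns equalities of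
  labels into equalities of triples.\<close>

lemma inj_on_form_value:
  assumes "\<nexists>k::int. N = k\<^sup>2" "N > 0"
  shows "inj_on (form_value N) (forms N)"
proof (rule inj_onI)
  fix t t' assume mem: "t \<in> forms N" "t' \<in> forms N"
    and eq: "form_value N t = form_value N t'"
  obtain c d e c' d' e' where t: "t = (c, d, e)" "t' = (c', d', e')"
    by (cases t, cases t') blast
  have "1 / real_of_int d = 1 / of_int d'" "real_of_int c / of_int d = of_int c' / of_int d'"
    using quadratic_coeffs_unique[OF sqrt_int_irrational[OF assms],
        of "1 / of_int d" "of_int c / of_int d" "1 / of_int d'" "of_int c' / of_int d'"]
      eq by (simp_all add: t quad_irr_coeffs)
  then have "d = d'" "c = c'" using mem by (auto simp: t forms_def)
  then show "t = t'" using mem by (auto simp: t forms_def)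
qed

section \<open>The path in terms of triples\<close>

lemma child_triple_form:
  assumes "\<nexists>k::int. N = k\<^sup>2" "(c, d, e) \<in> forms N"
  shows "fst (child_triple N Left (1, c, d)) = 1 \<longleftrightarrow> dir (c, d, e) = Left"
    and "child_triple N (dir (c, d, e)) (1, c, d) =
      (1, fst (step (c, d, e)), fst (snd (step (c, d, e))))"
proof -
  have de: "d > 0" "e > 0" and N: "N = c\<^sup>2 + d * e" using assms(2) by (auto simp: forms_def)
  \<comment> \<open>These factorizations make the integer divisions exact and reduce the test in the
    tree to the sign used by \<open>dir\<close>.\<close>
  have *: "N - (c + d)\<^sup>2 = d * (e - 2 * c - d)" "N - c\<^sup>2 = d * e"
    "(c + d)\<^sup>2 - N = d * (d + 2 * c - e)"
    unfolding N by (auto simp: power2_eq_square algebra_simps)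
  have pos: "N - (c + d)\<^sup>2 > 0 \<longleftrightarrow> d + 2 * c - e < 0"
    unfolding * using de by (auto simp: zero_less_mult_iff)
  show "fst (child_triple N Left (1, c, d)) = 1 \<longleftrightarrow> dir (c, d, e) = Left"
    using pos by simp
  show "child_triple N (dir (c, d, e)) (1, c, d) =
      (1, fst (step (c, d, e)), fst (snd (step (c, d, e))))"
    using pos de by (auto simp: *)
qed

lemma child_label_form_value:
  assumes "\<nexists>k::int. N = k\<^sup>2" "N > 0" "t \<in> forms N"
  shows "child_label (dir t) (form_value N t) = form_value N (step t)"
proof -
  obtain c d e where t: "t = (c, d, e)" by (cases t)
  have de: "d > 0" "e > 0" and N: "N = c\<^sup>2 + d * e"
    using assms(3) by (auto simp: forms_def t)
  show ?thesis
  proof (cases "d + 2 * c - e < 0")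
    case True
    then show ?thesis using de by (simp add: t quad_irr_def field_simps)
  next
    case False
    define s where "s = sqrt (of_int N)"
    have s2: "s * s = real_of_int c * real_of_int c + real_of_int d * real_of_int e"
      using assms(2) by (simp add: s_def) (simp add: N power2_eq_square)
    have "0 < d + 2 * c - e"
      using False forms_discriminant_nonzero[of N c d e] assms by (auto simp: t)
    then have pos: "real_of_int d + 2 * of_int c - of_int e > 0" by linarith
    have "\<bar>c\<bar> < s"
    proof -
      have "real_of_int (c\<^sup>2) < of_int N" using de by (simp add: N)
      then show ?thesis unfolding s_def by (intro real_less_rsqrt) simp
    qed
    then have "s + of_int c > 0" by linarith
    then have "s + of_int c + of_int d > 0" using de by simp
    \<comment> \<open>This is the cross-multiplied equality of the two fractions; both sides differ
      by \<open>s * s - c * c - d * e\<close>, which vanishes.\<close>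
    moreover have "(s + of_int c) * (of_int d + 2 * of_int c - of_int e) =
        (s + of_int c - of_int e) * (s + of_int c + of_int d)"
      using s2 by (simp add: algebra_simps)
    ultimately have "(s + of_int c) / (s + of_int c + of_int d) =
        (s + of_int c - of_int e) / (of_int d + 2 * of_int c - of_int e)"
      using pos by (simp add: frac_eq_eq)
    moreover have "(s + of_int c) / of_int d / ((s + of_int c) / of_int d + 1) =
        (s + of_int c) / (s + of_int c + of_int d)"
      using de by (simp add: divide_simps)
    ultimately show ?thesis
      using False by (simp add: t quad_irr_def add_diff_eq flip: s_def)
  qed
qed

lemma lpp_form:
  assumes "\<nexists>k::int. N = k\<^sup>2" "N > 0" "(p, q, r) \<in> forms N"
  defines "S \<equiv> \<lambda>n. (step ^^ n) (p, q, r)"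
  shows "cw_triple N p q (lpp N p q n) = (1, fst (S n), fst (snd (S n)))"
    and "lpp_seq N p q n = form_value N (S n)"
    and "lpp N p q (Suc n) = dir (S n) # lpp N p q n"
proof -
  have mem: "S n \<in> forms N" for n
    unfolding S_def by (rule funpow_step_in_forms[OF assms(1,3)])
  \<comment> \<open>The direction is derived conditionally on the triple because the induction for
    the triple needs it at every stage.\<close>
  have next_vertex: "lpp N p q (Suc n) = dir (S n) # lpp N p q n"
    if "cw_triple N p q (lpp N p q n) = (1, fst (S n), fst (snd (S n)))" for n
  proof -
    obtain c d e where t: "S n = (c, d, e)" by (cases "S n")
    have "dir (S n) = Left \<or> dir (S n) = Right" by (cases "dir (S n)") auto
    then show ?thesis
      using child_triple_form(1)[OF assms(1) mem[of n, unfolded t]] that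
      by (auto simp: t simp del: child_triple.simps dir.simps)
  qed
  have triple: "cw_triple N p q (lpp N p q n) = (1, fst (S n), fst (snd (S n)))" for n
  proof (induction n)
    case (Suc n)
    obtain c d e where t: "S n = (c, d, e)" by (cases "S n")
    have "S (Suc n) = step (S n)" by (simp add: S_def)
    then show ?case
      using child_triple_form(2)[OF assms(1) mem[of n, unfolded t]] Suc next_vertex[OF Suc]
      by (simp add: t del: child_triple.simps dir.simps step.simps lpp.simps)
  qed (simp add: S_def)
  then show "cw_triple N p q (lpp N p q n) = (1, fst (S n), fst (snd (S n)))" .
  have vertex: "lpp N p q (Suc n) = dir (S n) # lpp N p q n" for n
    using next_vertex[OF triple] .
  then show "lpp N p q (Suc n) = dir (S n) # lpp N p q n" .
  show "lpp_seq N p q n = form_value N (S n)"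
  proof (induction n)
    case (Suc n)
    have "S (Suc n) = step (S n)" by (simp add: S_def)
    then show ?case
      using Suc child_label_form_value[OF assms(1,2) mem[of n]] vertex[of n]
      by (simp add: lpp_seq_def del: lpp.simps)
  qed (simp add: S_def lpp_seq_def)
qed

theorem proposition4:
  fixes N p q :: int and m n :: nat
  assumes "N > 0" and "\<nexists>k::int. N = k\<^sup>2"
    and "p\<^sup>2 < N"
    and "q > 0" and "q dvd N - p\<^sup>2"
    and "m \<in> {1..lpp_period N p q}"
    and "lpp_seq N p q m = - quad_conj N (quad_irr N p q)"
    and "n \<in> {0..m}"
  shows "lpp_seq N p q (m - n) = - quad_conj N (lpp_seq N p q n) \<and>
    (let k = (if n = m then lpp_period N p q else m - n) in
       (is_left_child N p q (n + 1) \<and> is_left_child N p q k) \<or>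
       (is_right_child N p q (n + 1) \<and> is_right_child N p q k))"
proof -
  note N = assms(2,1)
  obtain r where r: "N - p\<^sup>2 = q * r" using assms(5) by (rule dvdE)
  with assms(3,4) have "0 < q * r" by linarith
  with assms(4) have "0 < r" by (simp add: zero_less_mult_iff)
  with r assms(4) have t0: "(p, q, r) \<in> forms N" by (simp add: forms_def)
  define S where "S n = (step ^^ n) (p, q, r)" for n
  note path = lpp_form[OF N t0, folded S_def]
  have mem: "S n \<in> forms N" for n
    unfolding S_def by (rule funpow_step_in_forms[OF N(1) t0])
  have S_eq: "S i = t" if "form_value N (S i) = form_value N t" "t \<in> forms N" for i t
    using inj_onD[OF inj_on_form_value[OF N] that(1) mem that(2)] .
  have "form_value N (S m) = form_value N (mirror (p, q, r))"
    using assms(7) path(2)[of m] quad_conj_form_value[OF N, of "(p, q, r)"] by simp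
  then have "S m = mirror (p, q, r)"
    using S_eq mirror_in_forms[OF t0] by blast
  then have reflect: "S (m - i) = mirror (S i)" if "i \<le> m" for i
    using mirror_funpow_step[OF N(1) t0 _ that] by (simp add: S_def)
  define T where "T = lpp_period N p q"
  \<comment> \<open>A positive return time must exist before the least one can be known to have the
    defining property.\<close>
  obtain k where "0 < k" "S k = (p, q, r)"
    using step_orbit_periodic[OF N(1) t0] unfolding S_def .
  then have "0 < k \<and> lpp_seq N p q k = quad_irr N p q" by (simp add: path(2))
  then have T: "0 < T" "lpp_seq N p q T = quad_irr N p q"
    using LeastI[of "\<lambda>t. 0 < t \<and> lpp_seq N p q t = quad_irr N p q"]
    by (auto simp: T_def lpp_period_def)
  then have ST: "S T = S 0"
    using S_eq[of T "(p, q, r)"] t0 by (simp add: path(2)) (simp add: S_def)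
  have n: "n \<le> m" using assms(8) by simp
  \<comment> \<open>For \<open>n = m\<close> the index 0 has no incoming step; \<open>T\<close>
    replaces it, with the same triple.\<close>
  define k where "k = (if n = m then T else m - n)"
  have k: "0 < k" using T n by (auto simp: k_def)
  have "S k = S (m - n)" by (simp add: k_def ST)
  then have "step (S (k - 1)) = mirror (S n)"
    using k reflect[OF n] by (cases k) (auto simp: S_def)
  \<comment> \<open>\<open>dir (S j)\<close> is the direction from index \<open>j\<close> to
    \<open>j + 1\<close>, so the step into \<open>k\<close> is read at \<open>k - 1\<close>; the
    mirror of its target is \<open>S n\<close>.\<close>
  then have "dir (S n) = dir (S (k - 1))"
    using step_mirror_step(2)[OF N(1) mem, of "k - 1"] by simp
  then have "lpp N p q (n + 1) = dir (S n) # lpp N p q n"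
    "lpp N p q k = dir (S n) # lpp N p q (k - 1)"
    using path(3)[of n] path(3)[of "k - 1"] k by (simp_all del: lpp.simps)
  then have "(is_left_child N p q (n + 1) \<and> is_left_child N p q k) \<or>
      (is_right_child N p q (n + 1) \<and> is_right_child N p q k)"
    by (cases "dir (S n)") (simp_all add: is_left_child_def is_right_child_def del: lpp.simps)
  moreover have "lpp_seq N p q (m - n) = - quad_conj N (lpp_seq N p q n)"
    using quad_conj_form_value[OF N, of "S n"] by (simp add: path(2) reflect[OF n])
  ultimately show ?thesis unfolding Let_def k_def T_def by (rule conjI[rotated])
qed

end
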